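(* Consider the heterogeneous discrete Bass model on the two-sided circle with $M$ nodes, where each nonadopter $j$ adopts at rate $p_j+q_{j-1,j}X_{j-1}(t)+q_{j+1,j}X_{j+1}(t)$. For $m,n\ge 0$, let $[S_{m,n}^j](t)$ be the probability that the $m+n+1$ nodes $j-m,\dots,j,\dots,j+n$ are all nonadopters at time $t$. Then for any $1\le j\le M$ and any $m,n\ge0$ with $0\le m+n\le M-2$, $$\frac{d}{dt}[S_{m,n}^j](t)=-\Big(\Big(\sum_{i=j-m}^{j+n}p_i\Big)+q_{j-m-1,j-m}+q_{j+n+1,j+n}\Big)[S_{m,n}^j](t)+q_{j+n+1,j+n}[S_{m,n+1}^j](t)+q_{j-m-1,j-m}[S_{m+1,n}^j](t),$$ and $$\frac{d}{dt}[S_M](t)=\Big(-\sum_{i=1}^M p_i\Big)[S_M](t),$$ with initial conditions $[S_{m,n}^j](0)=1$ for $0\le m+n\le M-1$, where $[S_M](t):=[S_{M-1,0}^j](t)=[S_{M-2,1}^j](t)=\dots=[S_{0,M-1}^j](t)$.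
   Context: Two-sided circle model: nodes $1,\dots,M$ with external rates $p_j\ge0$ and internal rates $q_{j-1,j},q_{j+1,j}\ge0$ (influence of the left and right neighbor on $j$). $X_j(t)\in\{0,1\}$ is the state of node $j$ ($1$ = adopter, $0$ = nonadopter), $X_j(0)=0$ for all $j$. The process $(X_1,\dots,X_M)$ is a continuous-time Markov chain in which adopters remain adopters forever, and each nonadopter $j$ becomes an adopter at rate $p_j+q_{j-1,j}X_{j-1}(t)+q_{j+1,j}X_{j+1}(t)$ (one node changes at a time). Node subscripts are understood modulo $M$, in $\{1,\dots,M\}$ (e.g. node $0$ is node $M$). *)

theory Defs
  imports "HOL-Probability.Probability"
begin

text \<open>
  A time-homogeneous continuous-time Markov chain \<open>X\<close> on a finite state set \<open>S\<close>, given by its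
  infinitesimal description: \<open>Q x y\<close> (for \<open>x \<noteq> y\<close>) is the rate of jumping from \<open>x\<close> to \<open>y\<close>, i.e.
  \<open>P (X (t + h) = y | X t = x) = Q x y * h + o(h)\<close> as \<open>h\<close> tends to 0 from the right, uniformly
  in \<open>t\<close>. The uniformity cannot be dropped: otherwise jumps at deterministic times would be
  allowed. Values of \<open>Q\<close> on the diagonal are irrelevant, and conditional probabilities are
  only constrained when the conditioning event has positive probability.
\<close>

locale finite_ctmc = prob_space \<Omega>
  for \<Omega> :: "'w measure" and S :: "'s set" and X :: "real \<Rightarrow> 'w \<Rightarrow> 's"
    and Q :: "'s \<Rightarrow> 's \<Rightarrow> real" +
  assumes finite_states: "finite S"
    and measurable_state: "\<And>t. 0 \<le> t \<Longrightarrow> X t \<in> \<Omega> \<rightarrow>\<^sub>M count_space S"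
    and markov: "\<And>(n::nat) (\<tau>::nat \<Rightarrow> real) (x::nat \<Rightarrow> 's).
      \<lbrakk>0 \<le> \<tau> 0; strict_mono_on {..Suc n} \<tau>; x ` {..Suc n} \<subseteq> S;
        \<P>(\<omega> in \<Omega>. \<forall>i\<le>n. X (\<tau> i) \<omega> = x i) > 0\<rbrakk> \<Longrightarrow>
      \<P>(\<omega> in \<Omega>. X (\<tau> (Suc n)) \<omega> = x (Suc n) \<bar> \<forall>i\<le>n. X (\<tau> i) \<omega> = x i) =
      \<P>(\<omega> in \<Omega>. X (\<tau> (Suc n)) \<omega> = x (Suc n) \<bar> X (\<tau> n) \<omega> = x n)"
    and rates: "\<And>x y. \<lbrakk>x \<in> S; y \<in> S; x \<noteq> y\<rbrakk> \<Longrightarrow>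
      uniform_limit {t. 0 \<le> t \<and> \<P>(\<omega> in \<Omega>. X t \<omega> = x) > 0}
        (\<lambda>h t. \<P>(\<omega> in \<Omega>. X (t + h) \<omega> = y \<bar> X t \<omega> = x) / h) (\<lambda>t. Q x y) (at_right 0)"

text \<open>Representative in \<open>{1..M}\<close> of a node subscript modulo \<open>M\<close>; in particular 0 becomes \<open>M\<close>.\<close>

definition node :: "nat \<Rightarrow> int \<Rightarrow> int" where
  "node M i = (i - 1) mod int M + 1"

definition config :: "nat \<Rightarrow> (int \<Rightarrow> nat) set" where
  "config M = {1..int M} \<rightarrow>\<^sub>E {0, 1}"

definition adoption_rate ::
    "nat \<Rightarrow> (int \<Rightarrow> real) \<Rightarrow> (int \<Rightarrow> int \<Rightarrow> real) \<Rightarrow> (int \<Rightarrow> nat) \<Rightarrow> int \<Rightarrow> real" where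
  "adoption_rate M p q x j =
     p j + q (node M (j - 1)) j * real (x (node M (j - 1)))
         + q (node M (j + 1)) j * real (x (node M (j + 1)))"

text \<open>
  The sum has at most one term: it is nonempty only if \<open>y\<close> arises from \<open>x\<close> by the adoption of a
  single nonadopter. All other transitions have rate 0.
\<close>

definition bass_rate ::
    "nat \<Rightarrow> (int \<Rightarrow> real) \<Rightarrow> (int \<Rightarrow> int \<Rightarrow> real) \<Rightarrow> (int \<Rightarrow> nat) \<Rightarrow> (int \<Rightarrow> nat) \<Rightarrow> real" where
  "bass_rate M p q x y =
     (\<Sum>j | j \<in> {1..int M} \<and> x j = 0 \<and> y = x(j := 1). adoption_rate M p q x j)"

text \<open>\<open>X t \<omega> j\<close> is the state at time \<open>t \<ge> 0\<close> of node \<open>j\<close>.\<close>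

locale circle_bass = finite_ctmc \<Omega> "config M" X "bass_rate M p q"
  for \<Omega> :: "'w measure" and M :: nat and p :: "int \<Rightarrow> real" and q :: "int \<Rightarrow> int \<Rightarrow> real"
    and X :: "real \<Rightarrow> 'w \<Rightarrow> int \<Rightarrow> nat" +
  assumes M_pos: "1 \<le> M"
    and p_nonneg: "\<And>j. j \<in> {1..int M} \<Longrightarrow> 0 \<le> p j"
    and q_left_nonneg: "\<And>j. j \<in> {1..int M} \<Longrightarrow> 0 \<le> q (node M (j - 1)) j"
    and q_right_nonneg: "\<And>j. j \<in> {1..int M} \<Longrightarrow> 0 \<le> q (node M (j + 1)) j"
    and initial: "AE \<omega> in \<Omega>. \<forall>j\<in>{1..int M}. X 0 \<omega> j = 0"
    and adopters_remain: "AE \<omega> in \<Omega>. \<forall>j\<in>{1..int M}. \<forall>s t.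
      0 \<le> s \<and> s \<le> t \<and> X s \<omega> j = 1 \<longrightarrow> X t \<omega> j = 1"

text \<open>The probability \<open>[S_{m,n}^j](t)\<close> that nodes \<open>j - m, \<dots>, j + n\<close> are all nonadopters.\<close>

definition nonadopters_prob ::
    "'w measure \<Rightarrow> nat \<Rightarrow> (real \<Rightarrow> 'w \<Rightarrow> int \<Rightarrow> nat) \<Rightarrow> int \<Rightarrow> nat \<Rightarrow> nat \<Rightarrow> real \<Rightarrow> real" where
  "nonadopters_prob \<Omega> M X j m n t =
     \<P>(\<omega> in \<Omega>. \<forall>i\<in>{j - int m..j + int n}. X t \<omega> (node M i) = 0)"

text \<open>
  \<open>[S_M](t)\<close>, taken as \<open>[S_{M-1,0}^j](t)\<close> with \<open>j = M\<close>, whose nodes are \<open>1, \<dots>, M\<close>.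
\<close>

definition all_nonadopters_prob ::
    "'w measure \<Rightarrow> nat \<Rightarrow> (real \<Rightarrow> 'w \<Rightarrow> int \<Rightarrow> nat) \<Rightarrow> real \<Rightarrow> real" where
  "all_nonadopters_prob \<Omega> M X t = nonadopters_prob \<Omega> M X (int M) (M - 1) 0 t"

end

theory Submission
  imports Defs
begin

text \<open>
  For any function \<open>f\<close> of the state, the increment of \<open>E f(X t)\<close> over \<open>[t, t + h]\<close> is
  \<open>h * E (L f)(X t) + o(h)\<close> uniformly in \<open>t\<close>, where \<open>L\<close> is the generator of the chain. The
  uniformity makes \<open>E f(X t)\<close> continuous; applied to \<open>L f\<close> as well, it upgrades the right
  derivative to a two-sided one, so \<open>d/dt E f(X t) = E (L f)(X t)\<close>. When \<open>f\<close> is the indicator of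
  "all nodes of an arc are nonadopters", \<open>L f\<close> is \<open>- f\<close> times the total adoption rate of the arc.
  On the event, inner neighbours exert no influence, and the outer neighbour \<open>k\<close> at either end
  contributes through \<open>f * X_k = f - f * (1 - X_k)\<close>, where \<open>f * (1 - X_k)\<close> is the indicator of
  the arc extended by \<open>k\<close>.
\<close>

subsection \<open>The forward equation of a finite chain\<close>

text \<open>For \<open>y < t\<close> the difference quotient at \<open>t\<close> is the right
  quotient based at \<open>y\<close> with step \<open>t - y\<close>. Uniformity compares it with
  \<open>G y\<close>, and continuity of \<open>G\<close> replaces \<open>G y\<close> by
  \<open>G t\<close>.\<close>

lemma uniform_right_derivative_imp_derivative:
  fixes u G :: "real \<Rightarrow> real"
  assumes incr: "\<And>e. e > 0 \<Longrightarrow>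
      \<forall>\<^sub>F h in at_right 0. \<forall>t\<ge>0. \<bar>u (t + h) - u t - h * G t\<bar> \<le> e * h"
    and cont: "continuous_on {0..} G"
    and t: "t \<ge> 0"
  shows "(u has_real_derivative G t) (at t within {0..})"
  unfolding has_field_derivative_iff tendsto_iff
proof (intro allI impI)
  fix e :: real assume e: "e > 0"
  obtain d where d: "d > 0"
    and incr': "\<And>h s. 0 < h \<Longrightarrow> h < d \<Longrightarrow> 0 \<le> s \<Longrightarrow> \<bar>u (s + h) - u s - h * G s\<bar> \<le> e / 2 * h"
    using incr[of "e / 2"] e unfolding eventually_at_right_field by auto
  have quot: "\<bar>(u (s + h) - u s) / h - G s\<bar> \<le> e / 2" if "0 < h" "h < d" "0 \<le> s" for h s
  proof -
    have "(u (s + h) - u s) / h - G s = (u (s + h) - u s - h * G s) / h"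
      using that by (simp add: field_simps)
    with incr'[OF that] that show ?thesis by (simp add: abs_divide field_simps)
  qed
  from cont t have "(G \<longlongrightarrow> G t) (at t within {0..})"
    by (simp add: continuous_on_def)
  then have "\<forall>\<^sub>F y in at t within {0..}. dist (G y) (G t) < e / 2"
    using e by (auto dest!: tendstoD[of _ _ _ "e / 2"])
  moreover have "\<forall>\<^sub>F y in at t within {0..}. dist y t < d"
    using d by (auto simp: eventually_at)
  moreover have "\<forall>\<^sub>F y in at t within {0..}. y \<in> {0..} \<and> y \<noteq> t"
    by (auto simp: eventually_at intro: exI[of _ 1])
  ultimately show "\<forall>\<^sub>F y in at t within {0..}. dist ((u y - u t) / (y - t)) (G t) < e"
  proof eventually_elim
    case (elim y)
    show ?case
    proof (cases "t < y")
      case True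
      with quot[of "y - t" t] elim t e show ?thesis by (simp add: dist_real_def)
    next
      case False
      have "(u y - u t) / (y - t) = (u t - u y) / (t - y)"
        by (metis minus_diff_eq minus_divide_divide)
      moreover have "\<bar>(u t - u y) / (t - y) - G y\<bar> \<le> e / 2"
        using quot[of "t - y" y] elim False by (simp add: dist_real_def)
      ultimately show ?thesis using elim(1) unfolding dist_real_def by linarith
    qed
  qed
qed

text \<open>A uniform increment estimate with bounded \<open>G\<close> gives a Lipschitz bound at
  small distances. Points to the left of \<open>t\<close> are covered by stepping from them up to
  \<open>t\<close>.\<close>

lemma uniform_right_increment_imp_continuous:
  fixes u G :: "real \<Rightarrow> real"
  assumes incr: "\<And>e. e > 0 \<Longrightarrow>
      \<forall>\<^sub>F h in at_right 0. \<forall>t\<ge>0. \<bar>u (t + h) - u t - h * G t\<bar> \<le> e * h"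
    and bound: "\<And>t. t \<ge> 0 \<Longrightarrow> \<bar>G t\<bar> \<le> K"
  shows "continuous_on {0..} u"
  unfolding continuous_on_iff
proof (intro ballI allI impI)
  fix t e :: real assume t: "t \<in> {0..}" and e: "e > 0"
  have K: "K \<ge> 0" using bound[of 0] by simp
  obtain d where d: "d > 0"
    and incr': "\<And>h s. 0 < h \<Longrightarrow> h < d \<Longrightarrow> 0 \<le> s \<Longrightarrow> \<bar>u (s + h) - u s - h * G s\<bar> \<le> h"
    using incr[of 1] unfolding eventually_at_right_field by auto
  \<comment> \<open>The error is at most \<open>h\<close> (tolerance 1) and the main term at most
    \<open>K * h\<close>, whence the constant \<open>K + 1\<close>.\<close>
  have step: "\<bar>u (s + h) - u s\<bar> \<le> (K + 1) * h" if "0 < h" "h < d" "0 \<le> s" for h s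
  proof -
    have "\<bar>h * G s\<bar> \<le> h * K" using bound[OF that(3)] that by (simp add: abs_mult)
    with incr'[OF that] show ?thesis by (simp add: algebra_simps)
  qed
  have lip: "\<bar>u y - u t\<bar> \<le> (K + 1) * \<bar>y - t\<bar>" if "y \<ge> 0" "\<bar>y - t\<bar> < d" for y
    using step[of "y - t" t] step[of "t - y" y] that t by (cases y t rule: linorder_cases) auto
  have "\<bar>u y - u t\<bar> < e" if "y \<ge> 0" "\<bar>y - t\<bar> < min d (e / (K + 1))" for y
  proof -
    have "(K + 1) * \<bar>y - t\<bar> < e" using that K by (simp add: field_simps)
    with lip[of y] that show ?thesis by simp
  qed
  then show "\<exists>d>0. \<forall>y\<in>{0..}. dist y t < d \<longrightarrow> dist (u y) (u t) < e"
    using d e K by (intro exI[of _ "min d (e / (K + 1))"]) (auto simp: dist_real_def)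
qed

section \<open>Expectations of functions of the state\<close>

context finite_ctmc
begin

definition law :: "real \<Rightarrow> 's \<Rightarrow> real"
  where "law t x = \<P>(\<omega> in \<Omega>. X t \<omega> = x)"

definition mean :: "('s \<Rightarrow> real) \<Rightarrow> real \<Rightarrow> real"
  where "mean f t = (\<Sum>x\<in>S. law t x * f x)"

text \<open>The form with differences keeps the unconstrained diagonal of \<open>Q\<close> out of
  the generator.\<close>

definition generator :: "('s \<Rightarrow> real) \<Rightarrow> 's \<Rightarrow> real"
  where "generator f x = (\<Sum>y\<in>S - {x}. Q x y * (f y - f x))"

lemma state_in: "0 \<le> t \<Longrightarrow> \<omega> \<in> space \<Omega> \<Longrightarrow> X t \<omega> \<in> S"
  using measurable_space[OF measurable_state] by auto

lemma state_event:
  assumes "0 \<le> t" shows "{\<omega> \<in> space \<Omega>. P (X t \<omega>)} \<in> events"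
proof -
  have "X t -` {x \<in> S. P x} \<inter> space \<Omega> \<in> events"
    by (rule measurable_sets[OF measurable_state[OF assms]]) auto
  also have "X t -` {x \<in> S. P x} \<inter> space \<Omega> = {\<omega> \<in> space \<Omega>. P (X t \<omega>)}"
    using state_in[OF assms] by auto
  finally show ?thesis .
qed

lemma prob_split_state:
  assumes t: "0 \<le> t" and P: "{\<omega> \<in> space \<Omega>. P \<omega>} \<in> events"
  shows "\<P>(\<omega> in \<Omega>. P \<omega>) = (\<Sum>x\<in>S. \<P>(\<omega> in \<Omega>. X t \<omega> = x \<and> P \<omega>))"
  by (rule prob_sum[OF finite_states _ P]) (use state_in[OF t] state_event[OF t] P in
    \<open>auto intro: sets.sets_Collect_conj\<close>)

lemma prob_state_eq_mean:
  assumes "0 \<le> t"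
  shows "\<P>(\<omega> in \<Omega>. P (X t \<omega>)) = mean (\<lambda>x. of_bool (P x)) t"
  unfolding mean_def law_def prob_split_state[OF assms state_event[OF assms]]
  by (intro sum.cong refl) (auto intro!: arg_cong[where f = prob] simp: of_bool_def cong: conj_cong)

lemma law_bounds: "0 \<le> law t x" "law t x \<le> 1"
  by (simp_all add: law_def)

lemma mean_bound: "\<bar>mean f t\<bar> \<le> (\<Sum>x\<in>S. \<bar>f x\<bar>)"
proof -
  have "\<bar>law t x * f x\<bar> \<le> \<bar>f x\<bar>" for x
    using law_bounds[of t x] by (simp add: abs_mult mult_left_le_one_le)
  then show ?thesis
    unfolding mean_def by (intro order_trans[OF sum_abs] sum_mono)
qed

text \<open>Multiplying the conditional estimate by \<open>law t x\<close>, which is at most 1,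
  preserves its error. Times with \<open>law t x = 0\<close> lie outside the scope of
  \<open>rates\<close>, but there the joint probability vanishes too, so the estimate is uniform
  over all \<open>t \<ge> 0\<close>.\<close>

lemma joint_law_increment:
  assumes x: "x \<in> S" and y: "y \<in> S" and ne: "x \<noteq> y" and e: "e > 0"
  shows "\<forall>\<^sub>F h in at_right 0. \<forall>t\<ge>0.
    \<bar>\<P>(\<omega> in \<Omega>. X t \<omega> = x \<and> X (t + h) \<omega> = y) - h * (law t x * Q x y)\<bar> \<le> e * h"
  using rates[OF x y ne, unfolded uniform_limit_iff, rule_format, OF e]
    eventually_at_right_less[of "0::real"]
proof eventually_elim
  case (elim h)
  show ?case
  proof (intro allI impI)
    fix t :: real assume t: "t \<ge> 0"
    let ?J = "\<P>(\<omega> in \<Omega>. X t \<omega> = x \<and> X (t + h) \<omega> = y)"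
    show "\<bar>?J - h * (law t x * Q x y)\<bar> \<le> e * h"
    proof (cases "law t x = 0")
      case True
      have "?J \<le> law t x"
        unfolding law_def by (rule finite_measure_mono) (auto intro: state_event[OF t])
      with True have "?J = 0" by (simp add: measure_le_0_iff)
      with True e elim show ?thesis by simp
    next
      case False
      then have pos: "law t x > 0" using law_bounds[of t x] by simp
      define c where "c = ?J / law t x / h"
      have "\<bar>c - Q x y\<bar> < e"
        using elim(1) t pos unfolding c_def law_def cond_prob_def dist_real_def
        by (auto simp: conj_commute)
      moreover have "?J - h * (law t x * Q x y) = h * (law t x * (c - Q x y))"
        using pos elim by (simp add: c_def field_simps)
      moreover have "law t x * \<bar>c - Q x y\<bar> \<le> \<bar>c - Q x y\<bar>"
        using law_bounds[of t x] by (simp add: mult_left_le_one_le)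
      ultimately show ?thesis using elim pos
        by (simp add: abs_mult mult.commute[of e])
    qed
  qed
qed

text \<open>Both laws are marginals of the joint law of \<open>X t\<close> and
  \<open>X (t + h)\<close>. The diagonal terms cancel, so no estimate for the probability of staying
  put is required.\<close>

lemma mean_increment_eq:
  assumes t: "0 \<le> t" and h: "0 \<le> h"
  shows "mean f (t + h) - mean f t =
    (\<Sum>x\<in>S. \<Sum>y\<in>S - {x}. \<P>(\<omega> in \<Omega>. X t \<omega> = x \<and> X (t + h) \<omega> = y) * (f y - f x))"
proof -
  let ?J = "\<lambda>x y. \<P>(\<omega> in \<Omega>. X t \<omega> = x \<and> X (t + h) \<omega> = y)"
  have th: "0 \<le> t + h" using t h by simp
  have 1: "law t x = (\<Sum>y\<in>S. ?J x y)" for x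
    unfolding law_def by (subst prob_split_state[OF th state_event[OF t]]) (simp add: conj_commute)
  have 2: "law (t + h) y = (\<Sum>x\<in>S. ?J x y)" for y
    unfolding law_def by (subst prob_split_state[OF t state_event[OF th]]) simp
  have "mean f (t + h) = (\<Sum>x\<in>S. \<Sum>y\<in>S. ?J x y * f y)"
    unfolding mean_def 2 sum_distrib_right by (rule sum.swap)
  moreover have "mean f t = (\<Sum>x\<in>S. \<Sum>y\<in>S. ?J x y * f x)"
    unfolding mean_def 1 sum_distrib_right ..
  ultimately have "mean f (t + h) - mean f t = (\<Sum>x\<in>S. \<Sum>y\<in>S. ?J x y * (f y - f x))"
    by (simp add: sum_subtractf algebra_simps)
  also have "\<dots> = (\<Sum>x\<in>S. \<Sum>y\<in>S - {x}. ?J x y * (f y - f x))"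
    by (intro sum.cong refl sum.mono_neutral_right) (auto simp: finite_states)
  finally show ?thesis .
qed

lemma mean_increment:
  assumes e: "e > 0"
  shows "\<forall>\<^sub>F h in at_right 0. \<forall>t\<ge>0.
    \<bar>mean f (t + h) - mean f t - h * mean (generator f) t\<bar> \<le> e * h"
proof -
  \<comment> \<open>The total weight of the differences, by which the tolerance for each pair of
    states is divided; the summand 1 keeps \<open>C\<close> positive when \<open>f\<close> is
    constant on \<open>S\<close>.\<close>
  define C where "C = 1 + (\<Sum>x\<in>S. \<Sum>y\<in>S - {x}. \<bar>f y - f x\<bar>)"
  have C: "C > 0"
    unfolding C_def by (intro add_pos_nonneg sum_nonneg) auto
  have "\<forall>\<^sub>F h in at_right 0. \<forall>x\<in>S. \<forall>y\<in>S - {x}. \<forall>t\<ge>0.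
      \<bar>\<P>(\<omega> in \<Omega>. X t \<omega> = x \<and> X (t + h) \<omega> = y) - h * (law t x * Q x y)\<bar> \<le> e / C * h"
    using e C finite_states by (intro eventually_ball_finite ballI joint_law_increment) auto
  then show ?thesis using eventually_at_right_less[of "0::real"]
  proof eventually_elim
    case (elim h)
    show ?case
    proof (intro allI impI)
      fix t :: real assume t: "t \<ge> 0"
      let ?D = "\<lambda>x y. \<P>(\<omega> in \<Omega>. X t \<omega> = x \<and> X (t + h) \<omega> = y) - h * (law t x * Q x y)"
      have "h * mean (generator f) t =
          (\<Sum>x\<in>S. \<Sum>y\<in>S - {x}. h * (law t x * Q x y) * (f y - f x))"
        by (simp add: mean_def generator_def sum_distrib_left mult_ac)
      then have increment_eq: "mean f (t + h) - mean f t - h * mean (generator f) t =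
          (\<Sum>x\<in>S. \<Sum>y\<in>S - {x}. ?D x y * (f y - f x))"
        using t elim(2) by (simp add: mean_increment_eq sum_subtractf left_diff_distrib)
      have "\<bar>mean f (t + h) - mean f t - h * mean (generator f) t\<bar> \<le>
          (\<Sum>x\<in>S. \<Sum>y\<in>S - {x}. \<bar>?D x y * (f y - f x)\<bar>)"
        unfolding increment_eq by (rule order_trans[OF sum_abs sum_mono]) (rule sum_abs)
      also have "\<dots> \<le> (\<Sum>x\<in>S. \<Sum>y\<in>S - {x}. e / C * h * \<bar>f y - f x\<bar>)"
      proof (intro sum_mono)
        fix x y assume "x \<in> S" "y \<in> S - {x}"
        then have "\<bar>?D x y\<bar> \<le> e / C * h" using elim(1) t by simp
        then show "\<bar>?D x y * (f y - f x)\<bar> \<le> e / C * h * \<bar>f y - f x\<bar>"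
          unfolding abs_mult by (rule mult_right_mono) simp
      qed
      also have "\<dots> = e / C * h * (C - 1)"
        by (simp add: C_def sum_distrib_left)
      also have "\<dots> = e * h - e / C * h" using C by (simp add: right_diff_distrib)
      also have "\<dots> \<le> e * h" using C e elim(2) by simp
      finally show "\<bar>mean f (t + h) - mean f t - h * mean (generator f) t\<bar> \<le> e * h" .
    qed
  qed
qed

lemma mean_continuous: "continuous_on {0..} (mean f)"
  by (rule uniform_right_increment_imp_continuous[OF mean_increment mean_bound])

lemma mean_has_derivative:
  assumes "0 \<le> t"
  shows "(mean f has_real_derivative mean (generator f) t) (at t within {0..})"
  \<comment> \<open>Here \<open>mean_continuous\<close> is used for \<open>generator f\<close> in
    place of \<open>f\<close>.\<close>
  by (rule uniform_right_derivative_imp_derivative[OF mean_increment mean_continuous assms])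

end

subsection \<open>Arcs of the circle\<close>

lemma node_in:
  assumes "1 \<le> M" shows "node M i \<in> {1..int M}"
proof -
  have "0 \<le> (i - 1) mod int M" "(i - 1) mod int M < int M" using assms by simp_all
  then show ?thesis unfolding node_def by simp
qed

lemma node_id: "i \<in> {1..int M} \<Longrightarrow> node M i = i"
  by (simp add: node_def)

lemma node_node_add [simp]: "node M (node M i + k) = node M (i + k)"
proof -
  have "((i - 1) mod int M + k) mod int M = (i - 1 + k) mod int M"
    by (rule mod_add_left_eq)
  then show ?thesis by (simp add: node_def algebra_simps)
qed

lemma node_node_diff [simp]: "node M (node M i - k) = node M (i - k)"
  using node_node_add[of M i "- k"] by simp

text \<open>Subscripts of the same node differ by a multiple of \<open>M\<close>, while those in the
  interval differ by less than \<open>M\<close>. This allows sums over the nodes of an arc to be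
  reindexed by subscripts.\<close>

lemma inj_on_node:
  assumes "b < a + int M" shows "inj_on (node M) {a..b}"
proof (rule inj_onI)
  fix i k assume i: "i \<in> {a..b}" and k: "k \<in> {a..b}" and eq: "node M i = node M k"
  have "int M dvd i - k"
    using eq by (simp add: node_def mod_eq_dvd_iff)
  moreover have "\<bar>i - k\<bar> < int M" using i k assms by auto
  ultimately show "i = k" using dvd_imp_le_int[of "i - k" "int M"] by force
qed

lemma node_image_full:
  assumes "1 \<le> M" "b = a + int M - 1" shows "node M ` {a..b} = {1..int M}"
proof (rule card_subset_eq)
  show "card (node M ` {a..b}) = card {1..int M}"
    using assms by (subst card_image[OF inj_on_node]) auto
qed (use node_in[OF assms(1)] in auto)

text \<open>The arc may have all \<open>M\<close> nodes, so the nodes \<open>a - 1\<close> and \<open>b + 1\<close> next to it may lie on it.\<close>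

definition arc_silent :: "nat \<Rightarrow> int \<Rightarrow> int \<Rightarrow> (int \<Rightarrow> nat) \<Rightarrow> real"
  where "arc_silent M a b x = of_bool (\<forall>i\<in>{a..b}. x (node M i) = 0)"

section \<open>The generator of the Bass model on indicators of arcs\<close>

context circle_bass
begin

lemma config_01: "x \<in> config M \<Longrightarrow> x (node M i) \<in> {0, 1}"
  using node_in[OF M_pos] by (auto simp: config_def PiE_def Pi_def)

lemma config_adopt:
  assumes "x \<in> config M" "j \<in> {1..int M}" "x j = 0"
  shows "x(j := 1) \<in> config M - {x}"
  using assms by (auto simp: config_def PiE_def Pi_def extensional_def fun_eq_iff)

text \<open>After exchanging the sums over target states and adopting nodes, each nonadopter
  \<open>j\<close> contributes the single target \<open>x(j := 1)\<close>, which by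
  \<open>config_adopt\<close> is among the states summed over.\<close>

lemma generator_eq:
  assumes x: "x \<in> config M"
  shows "generator f x =
    (\<Sum>j | j \<in> {1..int M} \<and> x j = 0. adoption_rate M p q x j * (f (x(j := 1)) - f x))"
proof -
  let ?J = "{j. j \<in> {1..int M} \<and> x j = 0}"
  let ?r = "adoption_rate M p q x"
  have fin: "finite ?J" by (rule finite_subset[of _ "{1..int M}"]) auto
  have rate: "bass_rate M p q x y = (\<Sum>j\<in>?J. if y = x(j := 1) then ?r j else 0)" for y
    unfolding bass_rate_def by (subst sum.inter_filter[OF fin, symmetric]) (simp add: conj_assoc)
  have "generator f x =
      (\<Sum>y\<in>config M - {x}. \<Sum>j\<in>?J. if y = x(j := 1) then ?r j * (f y - f x) else 0)"
    unfolding generator_def rate sum_distrib_right by (intro sum.cong refl) auto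
  also have "\<dots> = (\<Sum>j\<in>?J. \<Sum>y\<in>config M - {x}. if y = x(j := 1) then ?r j * (f y - f x) else 0)"
    by (rule sum.swap)
  also have "\<dots> = (\<Sum>j\<in>?J. ?r j * (f (x(j := 1)) - f x))"
    using config_adopt[OF x] finite_states by (intro sum.cong refl) (simp add: sum.delta)
  finally show ?thesis .
qed

text \<open>An adoption never makes \<open>I\<close> silent. It breaks silence exactly when the
  adopting node lies in \<open>I\<close>, and then the indicator drops by 1.\<close>

lemma generator_silent:
  assumes x: "x \<in> config M" and I: "I \<subseteq> {1..int M}"
  shows "generator (\<lambda>x. of_bool (\<forall>i\<in>I. x i = 0)) x =
    - of_bool (\<forall>i\<in>I. x i = 0) * (\<Sum>j\<in>I. adoption_rate M p q x j)"
proof (cases "\<forall>i\<in>I. x i = 0")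
  case False
  then obtain i where "i \<in> I" "x i \<noteq> 0" by auto
  \<comment> \<open>The adopter \<open>i\<close> in \<open>I\<close> survives every adoption; for
    \<open>j = i\<close> the update writes 1 there.\<close>
  then have not_silent: "(\<forall>i\<in>I. (x(j := 1)) i = 0) = False" for j
    by (cases "j = i") (auto intro: bexI[of _ i])
  from False have silent: "(\<forall>i\<in>I. x i = 0) = False" by blast
  show ?thesis unfolding generator_eq[OF x] not_silent silent by simp
next
  case True
  let ?J = "{j. j \<in> {1..int M} \<and> x j = 0}"
  have fin: "finite ?J" by (rule finite_subset[of _ "{1..int M}"]) auto
  have "(\<forall>i\<in>I. (x(j := 1)) i = 0) \<longleftrightarrow> j \<notin> I" for j using True by auto
  then have "generator (\<lambda>x. of_bool (\<forall>i\<in>I. x i = 0)) x =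
      (\<Sum>j\<in>?J. if j \<in> I then - adoption_rate M p q x j else 0)"
    unfolding generator_eq[OF x] using True by (intro sum.cong refl) auto
  also have "\<dots> = (\<Sum>j\<in>I. - adoption_rate M p q x j)"
    using True I by (subst sum.inter_filter[OF fin, symmetric]) (auto intro!: sum.cong)
  finally show ?thesis using True by (simp add: sum_negf)
qed

text \<open>A state is 0 or 1, so on a silent arc multiplying by the neighbour's state amounts to
  subtracting the indicator of the longer arc. If the neighbour already lies on the arc, both sides
  are 0.\<close>

lemma arc_silent_extend:
  assumes "x \<in> config M" "a \<le> b"
  shows "arc_silent M a b x * real (x (node M (a - 1))) = arc_silent M a b x - arc_silent M (a - 1) b x"
    and "arc_silent M a b x * real (x (node M (b + 1))) = arc_silent M a b x - arc_silent M a (b + 1) x"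
proof -
  have "{a - 1..b} = insert (a - 1) {a..b}" "{a..b + 1} = insert (b + 1) {a..b}"
    using assms(2) by auto
  then show
    "arc_silent M a b x * real (x (node M (a - 1))) =
      arc_silent M a b x - arc_silent M (a - 1) b x"
    "arc_silent M a b x * real (x (node M (b + 1))) =
      arc_silent M a b x - arc_silent M a (b + 1) x"
    using config_01[OF assms(1), of "a - 1"] config_01[OF assms(1), of "b + 1"]
    by (auto simp: arc_silent_def)
qed

lemma generator_arc_silent:
  assumes x: "x \<in> config M" and ab: "a \<le> b" "b < a + int M"
  defines "ql \<equiv> q (node M (a - 1)) (node M a)" and "qr \<equiv> q (node M (b + 1)) (node M b)"
  shows "generator (arc_silent M a b) x =
    - ((\<Sum>i = a..b. p (node M i)) + ql + qr) * arc_silent M a b x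
    + qr * arc_silent M a (b + 1) x + ql * arc_silent M (a - 1) b x"
proof -
  let ?s = "arc_silent M a b x"
  let ?l = "\<lambda>i. q (node M (i - 1)) (node M i) * real (x (node M (i - 1)))"
  let ?r = "\<lambda>i. q (node M (i + 1)) (node M i) * real (x (node M (i + 1)))"
  have silent: "arc_silent M a b = (\<lambda>x. of_bool (\<forall>i\<in>node M ` {a..b}. x i = 0))"
    by (simp add: arc_silent_def fun_eq_iff)
  have "generator (arc_silent M a b) x = - ?s * (\<Sum>j\<in>node M ` {a..b}. adoption_rate M p q x j)"
    unfolding silent by (rule generator_silent[OF x]) (use node_in[OF M_pos] in auto)
  also have "(\<Sum>j\<in>node M ` {a..b}. adoption_rate M p q x j) =
      (\<Sum>i = a..b. p (node M i)) + (\<Sum>i = a..b. ?l i) + (\<Sum>i = a..b. ?r i)"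
    by (subst sum.reindex[OF inj_on_node[OF ab(2)]]) (simp add: adoption_rate_def sum.distrib)
  finally have gen: "generator (arc_silent M a b) x =
      - ?s * ((\<Sum>i = a..b. p (node M i)) + (\<Sum>i = a..b. ?l i) + (\<Sum>i = a..b. ?r i))" .
  \<comment> \<open>On a silent arc the left neighbour of every \<open>i\<close> other than
    \<open>a\<close>, and the right neighbour of every \<open>i\<close> other than \<open>b\<close>,
    is a nonadopter, so only the two ends remain.\<close>
  have "?s * (\<Sum>i = a..b. ?l i) = ?s * ?l a \<and> ?s * (\<Sum>i = a..b. ?r i) = ?s * ?r b"
  proof (cases "?s = 0")
    case False
    then have zero: "x (node M i) = 0" if "i \<in> {a..b}" for i
      using that by (auto simp: arc_silent_def)
    have "(\<Sum>i = a..b. ?l i) = (\<Sum>i\<in>{a}. ?l i)"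
      using ab zero by (intro sum.mono_neutral_right) auto
    moreover have "(\<Sum>i = a..b. ?r i) = (\<Sum>i\<in>{b}. ?r i)"
      using ab zero by (intro sum.mono_neutral_right) auto
    ultimately show ?thesis by simp
  qed simp
  then have "?s * (\<Sum>i = a..b. ?l i) = ql * (?s * real (x (node M (a - 1))))"
    and "?s * (\<Sum>i = a..b. ?r i) = qr * (?s * real (x (node M (b + 1))))"
    by (simp_all add: ql_def qr_def)
  then show ?thesis
    unfolding gen arc_silent_extend[OF x ab(1)] by (simp add: algebra_simps)
qed

lemma mean_arc_silent_has_derivative:
  assumes t: "0 \<le> t" and ab: "a \<le> b" "b < a + int M"
  defines "ql \<equiv> q (node M (a - 1)) (node M a)" and "qr \<equiv> q (node M (b + 1)) (node M b)"
  shows "(mean (arc_silent M a b) has_real_derivative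
    - ((\<Sum>i = a..b. p (node M i)) + ql + qr) * mean (arc_silent M a b) t
    + qr * mean (arc_silent M a (b + 1)) t + ql * mean (arc_silent M (a - 1) b) t)
    (at t within {0..})"
proof -
  have "mean (generator (arc_silent M a b)) t =
      (\<Sum>x\<in>config M. law t x *
        (- ((\<Sum>i = a..b. p (node M i)) + ql + qr) * arc_silent M a b x
          + qr * arc_silent M a (b + 1) x + ql * arc_silent M (a - 1) b x))"
    unfolding mean_def ql_def qr_def
    by (intro sum.cong refl) (simp only: generator_arc_silent[OF _ ab])
  also have "\<dots> = - ((\<Sum>i = a..b. p (node M i)) + ql + qr) * mean (arc_silent M a b) t
      + qr * mean (arc_silent M a (b + 1)) t + ql * mean (arc_silent M (a - 1) b) t"
    unfolding mean_def sum_distrib_left sum.distrib[symmetric]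
    by (intro sum.cong refl) (simp add: algebra_simps)
  finally show ?thesis using mean_has_derivative[OF t, of "arc_silent M a b"] by simp
qed

section \<open>Differential equations for the nonadoption probabilities\<close>

lemma nonadopters_prob_eq_mean:
  "0 \<le> t \<Longrightarrow> nonadopters_prob \<Omega> M X j m n t = mean (arc_silent M (j - int m) (j + int n)) t"
  unfolding nonadopters_prob_def arc_silent_def
  by (rule prob_state_eq_mean[where P = "\<lambda>x. \<forall>i\<in>{j - int m..j + int n}. x (node M i) = 0"])

text \<open>The range \<open>m + n < M\<close> includes arcs that go once around the circle; that
  case yields the equation for \<open>[S_M]\<close>.\<close>

lemma nonadopters_prob_has_derivative:
  assumes t: "0 \<le> t" and mn: "m + n < M"
  shows "(nonadopters_prob \<Omega> M X j m n has_real_derivative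
    - ((\<Sum>i = j - int m..j + int n. p (node M i))
        + q (node M (j - int m - 1)) (node M (j - int m))
        + q (node M (j + int n + 1)) (node M (j + int n))) * nonadopters_prob \<Omega> M X j m n t
    + q (node M (j + int n + 1)) (node M (j + int n)) * nonadopters_prob \<Omega> M X j m (n + 1) t
    + q (node M (j - int m - 1)) (node M (j - int m)) * nonadopters_prob \<Omega> M X j (m + 1) n t)
    (at t within {0..})"
\<comment> \<open>The probability is identified with \<open>mean\<close> at nonnegative times only,
  which suffices for a derivative within \<open>{0..}\<close>; the radius 1 is arbitrary.\<close>
proof (rule has_field_derivative_transform_within[where d = 1])
  have shift: "j - int (m + 1) = j - int m - 1" "j + int (n + 1) = j + int n + 1" by simp_all
  show "(mean (arc_silent M (j - int m) (j + int n)) has_real_derivative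
    - ((\<Sum>i = j - int m..j + int n. p (node M i))
        + q (node M (j - int m - 1)) (node M (j - int m))
        + q (node M (j + int n + 1)) (node M (j + int n))) * nonadopters_prob \<Omega> M X j m n t
    + q (node M (j + int n + 1)) (node M (j + int n)) * nonadopters_prob \<Omega> M X j m (n + 1) t
    + q (node M (j - int m - 1)) (node M (j - int m)) * nonadopters_prob \<Omega> M X j (m + 1) n t)
    (at t within {0..})"
    unfolding nonadopters_prob_eq_mean[OF t] shift
    by (rule mean_arc_silent_has_derivative[OF t]) (use mn in auto)
qed (use t in \<open>auto simp: nonadopters_prob_eq_mean\<close>)

text \<open>The arc covers every node. The inequality also admits arcs that overlap themselves, such
  as a full arc extended by one more subscript.\<close>

lemma nonadopters_prob_full:
  assumes "M - 1 \<le> m + n"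
  shows "nonadopters_prob \<Omega> M X j m n t = \<P>(\<omega> in \<Omega>. \<forall>i\<in>{1..int M}. X t \<omega> i = 0)"
proof -
  let ?A = "{j - int m..j + int n}"
  have "{1..int M} = node M ` {j - int m..j - int m + int M - 1}"
    using M_pos by (simp add: node_image_full)
  also have "\<dots> \<subseteq> node M ` ?A" using assms by (intro image_mono) auto
  finally have "{1..int M} = node M ` ?A" using node_in[OF M_pos] by auto
  then show ?thesis by (simp add: nonadopters_prob_def)
qed

text \<open>Extending a full arc does not change its event, so the two gain terms cancel the two
  \<open>q\<close> terms in the loss rate.\<close>

lemma all_nonadopters_prob_has_derivative:
  assumes t: "0 \<le> t"
  shows "(all_nonadopters_prob \<Omega> M X has_real_derivative
    (- (\<Sum>i = 1..int M. p i)) * all_nonadopters_prob \<Omega> M X t) (at t within {0..})"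
proof -
  let ?S = "\<lambda>m n. nonadopters_prob \<Omega> M X (int M) m n"
  have SM: "all_nonadopters_prob \<Omega> M X = ?S (M - 1) 0"
    by (simp add: all_nonadopters_prob_def fun_eq_iff)
  have same: "?S (M - 1) (0 + 1) t = ?S (M - 1) 0 t" "?S (M - 1 + 1) 0 t = ?S (M - 1) 0 t"
    by (simp_all add: nonadopters_prob_full)
  have "(\<Sum>i = int M - int (M - 1)..int M + int 0. p (node M i)) = (\<Sum>i = 1..int M. p i)"
    using M_pos by (intro sum.cong) (auto simp: of_nat_diff node_id)
  then show ?thesis
    using nonadopters_prob_has_derivative[OF t, of "M - 1" 0 "int M"] M_pos
    unfolding SM same by (simp add: algebra_simps)
qed

lemma nonadopters_prob_initial: "nonadopters_prob \<Omega> M X j m n 0 = 1"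
  unfolding nonadopters_prob_def
proof (subst prob_Collect_eq_1)
  show "{\<omega> \<in> space \<Omega>. \<forall>i\<in>{j - int m..j + int n}. X 0 \<omega> (node M i) = 0} \<in> events"
    by (rule state_event[where P = "\<lambda>x. \<forall>i\<in>{j - int m..j + int n}. x (node M i) = 0"]) simp
  show "AE \<omega> in \<Omega>. \<forall>i\<in>{j - int m..j + int n}. X 0 \<omega> (node M i) = 0"
    using initial by eventually_elim (use node_in[OF M_pos] in blast)
qed

end

text \<open>Derivatives are within \<open>{0..}\<close>, hence one-sided at 0. The last conjunct
  shows that \<open>SM\<close> depends neither on the base node nor on how \<open>M - 1\<close> is
  split.\<close>

theorem lemma12:
  fixes \<Omega> :: "'w measure" and M :: nat and p :: "int \<Rightarrow> real" and q :: "int \<Rightarrow> int \<Rightarrow> real"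
    and X :: "real \<Rightarrow> 'w \<Rightarrow> int \<Rightarrow> nat"
  defines "S \<equiv> nonadopters_prob \<Omega> M X"
    and "SM \<equiv> all_nonadopters_prob \<Omega> M X"
  assumes "circle_bass \<Omega> M p q X"
  shows "(\<forall>j\<in>{1..int M}. \<forall>m n. m + n + 2 \<le> M \<longrightarrow> (\<forall>t\<ge>0.
            (S j m n has_real_derivative
               - ((\<Sum>i = j - int m..j + int n. p (node M i))
                   + q (node M (j - int m - 1)) (node M (j - int m))
                   + q (node M (j + int n + 1)) (node M (j + int n))) * S j m n t
               + q (node M (j + int n + 1)) (node M (j + int n)) * S j m (n + 1) t
               + q (node M (j - int m - 1)) (node M (j - int m)) * S j (m + 1) n t)
            (at t within {0..})))
       \<and> (\<forall>t\<ge>0. (SM has_real_derivative (- (\<Sum>i = 1..int M. p i)) * SM t) (at t within {0..}))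
       \<and> (\<forall>j\<in>{1..int M}. \<forall>m n. m + n \<le> M - 1 \<longrightarrow> S j m n 0 = 1)
       \<and> (\<forall>j\<in>{1..int M}. \<forall>m n. m + n = M - 1 \<longrightarrow> (\<forall>t\<ge>0. S j m n t = SM t))"
proof -
  interpret circle_bass \<Omega> M p q X by fact
  show ?thesis
    unfolding S_def SM_def
  proof (intro conjI ballI allI impI, goal_cases)
    case (1 j m n t)
    then show ?case by (intro nonadopters_prob_has_derivative) auto
  next
    case (2 t)
    then show ?case by (rule all_nonadopters_prob_has_derivative)
  next
    case (3 j m n)
    show ?case by (rule nonadopters_prob_initial)
  next
    case (4 j m n t)
    then show ?case by (simp add: all_nonadopters_prob_def nonadopters_prob_full)
  qed
qed

end
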